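(* If a family of vectors $\{\phi_i\}_{i=1}^n$ does weak phase retrieval in $\mathbb{R}^m$, then $n\geq 2m-2$.
   Context: A family $\{\phi_i\}_{i=1}^n$ of vectors in $\mathbb{R}^m$ does weak phase retrieval if for all $x=(a_1,\dots,a_m)$ and $y=(b_1,\dots,b_m)$ in $\mathbb{R}^m$ with $|\langle x,\phi_i\rangle|=|\langle y,\phi_i\rangle|$ for all $i=1,\dots,n$, the vectors $x,y$ weakly have the same phase, i.e. there is $\theta\in\{1,-1\}$ such that $\operatorname{sgn}(a_i)=\theta\operatorname{sgn}(b_i)$ for all $i\in\{1,\dots,m\}$ for which $a_i\neq 0\neq b_i$. *)

theory Defs
  imports "HOL-Analysis.Analysis"
begin

definition weakly_same_phase :: "real ^ 'm \<Rightarrow> real ^ 'm \<Rightarrow> bool" where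
  "weakly_same_phase x y \<longleftrightarrow>
     (\<exists>\<theta>\<in>{1, -1}. \<forall>i. x $ i \<noteq> 0 \<and> y $ i \<noteq> 0 \<longrightarrow> sgn (x $ i) = \<theta> * sgn (y $ i))"

(* The family is phi 1, ..., phi n; values of phi outside {1..n} are irrelevant.
   Repeated and zero vectors are allowed, as is the empty family (n = 0). *)
definition weak_phase_retrieval :: "nat \<Rightarrow> (nat \<Rightarrow> real ^ 'm) \<Rightarrow> bool" where
  "weak_phase_retrieval n \<phi> \<longleftrightarrow>
     (\<forall>x y. (\<forall>i\<in>{1..n}. \<bar>x \<bullet> \<phi> i\<bar> = \<bar>y \<bullet> \<phi> i\<bar>) \<longrightarrow> weakly_same_phase x y)"

end

theory Submission
  imports Defs
begin

text \<open>
  If every frame vector is orthogonal to \<open>x\<close> or to \<open>y\<close>, then \<open>x + t y\<close> and \<open>x - t y\<close> have the same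
  measurements for every real \<open>t\<close>.  The signs of their \<open>k\<close>-th coordinates are compared by the sign of
  \<open>x\<^sub>k\<^sup>2 - t\<^sup>2 y\<^sub>k\<^sup>2\<close>, so weak phase retrieval forbids this quantity to be positive for one \<open>k\<close> and
  negative for another.  A coordinate with \<open>x\<^sub>i \<noteq> 0 = y\<^sub>i\<close> makes it positive, and for large \<open>t\<close> a
  coordinate with \<open>y\<^sub>j \<noteq> 0\<close> makes it negative (lemma \<open>zero_if_coordinate_vanishes\<close>).

  With at most \<open>2m - 3\<close> vectors such a pair exists.  Split the family into at most \<open>m - 1\<close> and at
  most \<open>m - 2\<close> vectors: the first part has a nonzero orthogonal vector \<open>x\<close>, say with \<open>x\<^sub>i \<noteq> 0\<close>, and
  the second part leaves enough room to choose a nonzero orthogonal \<open>y\<close> that also satisfies the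
  equation \<open>y\<^sub>i = 0\<close>.
\<close>

lemma exists_nonzero_orthogonal:
  fixes S :: "'a::euclidean_space set"
  assumes "finite S" "card S < DIM('a)"
  obtains x where "x \<noteq> 0" "\<And>v. v \<in> S \<Longrightarrow> x \<bullet> v = 0"
proof -
  have "dim S < DIM('a)"
    using dim_le_card'[OF assms(1)] assms(2) by linarith
  then obtain x where "x \<noteq> 0" "\<And>v. v \<in> span S \<Longrightarrow> orthogonal x v"
    using orthogonal_to_subspace_exists by blast
  then show ?thesis
    using that by (meson orthogonal_def span_base)
qed

lemma zero_if_coordinate_vanishes:
  fixes \<phi> :: "nat \<Rightarrow> real ^ 'm" and x y :: "real ^ 'm"
  assumes wpr: "weak_phase_retrieval n \<phi>"
    and orth: "\<And>k. k \<in> {1..n} \<Longrightarrow> x \<bullet> \<phi> k = 0 \<or> y \<bullet> \<phi> k = 0"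
    and i: "x $ i \<noteq> 0" "y $ i = 0"
  shows "y = 0"
proof (rule ccontr)
  assume "y \<noteq> 0"
  then obtain j where j: "y $ j \<noteq> 0"
    by (auto simp: vec_eq_iff)
  \<comment> \<open>This scaling makes the \<open>j\<close>-th coordinate of \<open>t y\<close> exceed \<open>\<bar>x\<^sub>j\<bar>\<close>.\<close>
  define t where "t = (\<bar>x $ j\<bar> + 1) / y $ j"
  define u where "u = x + t *\<^sub>R y"
  define v where "v = x - t *\<^sub>R y"
  have "\<bar>u \<bullet> \<phi> k\<bar> = \<bar>v \<bullet> \<phi> k\<bar>" if "k \<in> {1..n}" for k
    using orth[OF that] by (auto simp: u_def v_def inner_add_left inner_diff_left)
  then have "weakly_same_phase u v"
    using wpr unfolding weak_phase_retrieval_def by blast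
  then obtain \<theta> where \<theta>: "\<And>k. u $ k \<noteq> 0 \<Longrightarrow> v $ k \<noteq> 0 \<Longrightarrow> sgn (u $ k) = \<theta> * sgn (v $ k)"
    unfolding weakly_same_phase_def by blast
  have "u $ i = x $ i" "v $ i = x $ i"
    using i by (simp_all add: u_def v_def)
  then have "\<theta> = 1"
    using \<theta>[of i] i by (simp add: sgn_zero_iff)
  moreover have "t * y $ j = \<bar>x $ j\<bar> + 1"
    using j by (simp add: t_def)
  then have "u $ j > 0" "v $ j < 0"
    by (simp_all add: u_def v_def)
  ultimately show False
    using \<theta>[of j] by simp
qed

theorem theorem3p7:
  fixes \<phi> :: "nat \<Rightarrow> real ^ 'm" and n :: nat
  assumes "weak_phase_retrieval n \<phi>"
  shows "n \<ge> 2 * CARD('m) - 2"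
proof (rule ccontr)
  assume "\<not> n \<ge> 2 * CARD('m) - 2"
  then have n: "n + 3 \<le> 2 * CARD('m)" by linarith
  define A where "A = \<phi> ` {1..<CARD('m)}"
  define B where "B = \<phi> ` {CARD('m)..n}"
  have "card A \<le> CARD('m) - 1"
    unfolding A_def using card_image_le[of "{1..<CARD('m)}" \<phi>] by simp
  then have "card A < DIM(real ^ 'm)"
    using n by simp
  moreover have "finite A" by (simp add: A_def)
  ultimately obtain x where x: "x \<noteq> 0" "\<And>v. v \<in> A \<Longrightarrow> x \<bullet> v = 0"
    using exists_nonzero_orthogonal by blast
  then obtain i where i: "x $ i \<noteq> 0"
    by (auto simp: vec_eq_iff)
  have "card B \<le> n + 1 - CARD('m)"
    unfolding B_def using card_image_le[of "{CARD('m)..n}" \<phi>] by simp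
  moreover have fB: "finite B" by (simp add: B_def)
  then have "card (insert (axis i 1) B) \<le> card B + 1"
    by (simp add: card_insert_if)
  ultimately have "card (insert (axis i 1) B) < DIM(real ^ 'm)"
    using n by simp
  then obtain y where y: "y \<noteq> 0" "\<And>v. v \<in> insert (axis i 1) B \<Longrightarrow> y \<bullet> v = 0"
    using exists_nonzero_orthogonal fB by blast
  have "y $ i = 0"
    using y(2)[of "axis i 1"] by (simp add: inner_axis)
  moreover have "x \<bullet> \<phi> k = 0 \<or> y \<bullet> \<phi> k = 0" if "k \<in> {1..n}" for k
    using that x(2) y(2) by (cases "k < CARD('m)") (auto simp: A_def B_def)
  ultimately have "y = 0"
    using zero_if_coordinate_vanishes[OF assms] i by blast
  with y(1) show False ..
qed

end
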